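(* Let $G$ be a finite simple graph of order $n \ge 2$, and let $\overline{G}$ denote its complement. Then $$\max\left\{\lambda_2(G), \lambda_2(\overline{G})\right\} \ge \frac{2}{5}.$$
   Context: All graphs are finite and simple (no loops and no multiple edges). The order of a graph is its number of vertices. The Laplacian of a graph $G$ is $L(G) = D(G) - A(G)$, where $A(G)$ is the adjacency matrix and $D(G)$ is the diagonal matrix of vertex degrees. The eigenvalues of $L(G)$, listed with multiplicity, are denoted $0 = \lambda_1(G) \le \lambda_2(G) \le \cdots \le \lambda_n(G)$, so $\lambda_2(G)$ is the second smallest Laplacian eigenvalue (the algebraic connectivity). The complement $\overline{G}$ has the same vertex set as $G$, and two distinct vertices are adjacent in $\overline{G}$ if and only if they are not adjacent in $G$. *)

theory Defs
  imports
    "Graph_Theory.Pair_Digraph"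
    "Jordan_Normal_Form.Char_Poly"
begin

text \<open>
  A finite simple graph is a \<open>pair_graph\<close>: a finite set of vertices with a symmetric
  irreflexive set of ordered pairs of vertices. Each undirected edge is thus a pair of opposite
  arcs, and the degree of a vertex is its out-degree.
\<close>

definition complement :: "'a pair_pre_digraph \<Rightarrow> 'a pair_pre_digraph" where
  "complement G =
    \<lparr> pverts = pverts G,
      parcs = {(u, v). u \<in> pverts G \<and> v \<in> pverts G \<and> u \<noteq> v \<and> (u, v) \<notin> parcs G} \<rparr>"

lemma pair_graph_complement:
  assumes "pair_graph G"
  shows "pair_graph (complement G)"
proof -
  interpret pair_graph G by fact
  have sub: "parcs (complement G) \<subseteq> pverts G \<times> pverts G"
    by (auto simp: complement_def)
  have fin: "finite (parcs (complement G))"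
    using sub pair_finite_verts by (meson finite_SigmaI finite_subset)
  have "sym (parcs G)"
    using pair_sym_arcs by (simp add: symmetric_def)
  then have sym: "sym (parcs (complement G))"
    by (auto simp: complement_def sym_def)
  show ?thesis
    using fin sym pair_finite_verts
    by unfold_locales (auto simp: complement_def symmetric_def)
qed

text \<open>
  Matrices are indexed by natural numbers, so the vertices are listed in some arbitrary order.
  A different order conjugates the matrices below by a permutation matrix, which leaves the
  characteristic polynomial unchanged.
\<close>

definition vertex_list :: "'a pair_pre_digraph \<Rightarrow> 'a list" where
  "vertex_list G = (SOME vs. distinct vs \<and> set vs = pverts G)"

lemma vertex_list:
  assumes "finite (pverts G)"
  shows "distinct (vertex_list G)" "set (vertex_list G) = pverts G"
    "length (vertex_list G) = card (pverts G)"
proof -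
  have "\<exists>vs. distinct vs \<and> set vs = pverts G"
    using finite_distinct_list[OF assms] by blast
  then have *: "distinct (vertex_list G) \<and> set (vertex_list G) = pverts G"
    unfolding vertex_list_def by (rule someI_ex)
  then show "distinct (vertex_list G)" "set (vertex_list G) = pverts G" by auto
  with distinct_card show "length (vertex_list G) = card (pverts G)" by fastforce
qed

definition adjacency_matrix :: "'a pair_pre_digraph \<Rightarrow> real mat" where
  "adjacency_matrix G = mat (card (pverts G)) (card (pverts G))
    (\<lambda>(i, j). if (vertex_list G ! i, vertex_list G ! j) \<in> parcs G then 1 else 0)"

definition degree_matrix :: "'a pair_pre_digraph \<Rightarrow> real mat" where
  "degree_matrix G = mat (card (pverts G)) (card (pverts G))
    (\<lambda>(i, j). if i = j then real (out_degree (with_proj G) (vertex_list G ! i)) else 0)"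

definition laplacian :: "'a pair_pre_digraph \<Rightarrow> real mat" where
  "laplacian G = degree_matrix G - adjacency_matrix G"

text \<open>
  The real roots of the characteristic polynomial, with multiplicity and in increasing order.
  The Laplacian of a \<open>pair_graph\<close> is a real symmetric matrix, so all its eigenvalues
  are real and the list has one entry per vertex.
\<close>

definition laplacian_eigenvalues :: "'a pair_pre_digraph \<Rightarrow> real list" where
  "laplacian_eigenvalues G = sorted_list_of_multiset (proots (char_poly (laplacian G)))"

text \<open>
  \<open>laplacian_eigenvalue k G\<close> is the \<open>k\<close>-th smallest eigenvalue,
  counting from \<open>k = 1\<close>.
\<close>

definition laplacian_eigenvalue :: "nat \<Rightarrow> 'a pair_pre_digraph \<Rightarrow> real" where
  "laplacian_eigenvalue k G = laplacian_eigenvalues G ! (k - 1)"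

end

theory Submission
  imports Defs
begin

text \<open>
  Suppose both values are below \<open>2 / 5\<close>, and take eigenvectors \<open>x\<close> of \<open>G\<close> and
  \<open>y\<close> of its complement, both orthogonal to the constants and scaled to have width
  \<open>max - min = 1\<close>. Let \<open>a, b\<close> be the extreme vertices of \<open>x\<close> and
  \<open>c, d\<close> those of \<open>y\<close>. By the eigenvalue equation at \<open>a\<close>, every neighbour
  of \<open>a\<close> has a value close to the maximum; likewise at \<open>b\<close>. Hence \<open>a, b\<close> are
  neither adjacent nor have a common neighbour, and the same holds for \<open>c, d\<close> in the complement.
  So \<open>a, c, d, b\<close> (up to exchanging \<open>c\<close> and \<open>d\<close>) induce a path, with edges
  \<open>ac, cd, db\<close>.

  Since a mean-zero vector of width 1 on \<open>n\<close> vertices has square norm at most \<open>n / 4\<close>,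
  each Dirichlet energy is less than \<open>n / 10\<close>. On the other hand, the edges of \<open>G\<close> meeting
  \<open>{c, d}\<close> and the edges of the complement meeting \<open>{a, b}\<close> already carry a total energy
  of at least \<open>n / 5\<close>: the edges \<open>cd\<close> and \<open>ba\<close> contribute \<open>2 / 5\<close> each,
  and every vertex \<open>v\<close> outside the path contributes \<open>1 / 5\<close>, because \<open>v\<close> either is
  adjacent to both \<open>c\<close> and \<open>d\<close>, or to neither \<open>a\<close> nor \<open>b\<close>, or else has an edge (in
  \<open>G\<close> or in the complement) across nearly the full width. Here the defect in the norm bound is
  counted as energy as well.
\<close>

section \<open>Eigenvectors orthogonal to the constants\<close>

text \<open>
  For a matrix with zero column sums, \<open>deflate A\<close> represents \<open>A\<close> restricted to the
  vectors with zero coordinate sum, in the basis \<open>e\<^sub>i - e\<^sub>m\<close> where \<open>m\<close> is the last index.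
\<close>

definition deflate :: "'a::ring_1 mat \<Rightarrow> 'a mat" where
  "deflate A = (let m = dim_row A - 1 in mat m m (\<lambda>(i, j). A $$ (i, j) - A $$ (i, m)))"

lemma deflate_carrier: "A \<in> carrier_mat (Suc m) (Suc m) \<Longrightarrow> deflate A \<in> carrier_mat m m"
  by (simp add: deflate_def)

text \<open>The columns of \<open>P\<close> form the basis e_0 - e_m, ..., e_(m-1) - e_m, e_m. In
  it, zero column sums make the last row vanish; deleting the last row and column leaves
  \<open>deflate A\<close>.\<close>

lemma char_poly_deflate:
  fixes A :: "'a::field mat"
  assumes A: "A \<in> carrier_mat (Suc m) (Suc m)"
    and col: "\<And>j. j < Suc m \<Longrightarrow> (\<Sum>i<Suc m. A $$ (i, j)) = 0"
  shows "char_poly A = [:0, 1:] * char_poly (deflate A)"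
proof -
  let ?n = "Suc m"
  define P where "P = mat ?n ?n (\<lambda>(i, j). if i = j then 1 else if i = m then -1 else (0 :: 'a))"
  define Q where "Q = mat ?n ?n (\<lambda>(i, j). if i = j \<or> i = m then 1 else (0 :: 'a))"
  define B where "B = mat ?n ?n (\<lambda>(i, j). if i = m then 0
      else if j = m then A $$ (i, m) else A $$ (i, j) - A $$ (i, m))"
  have carr: "P \<in> carrier_mat ?n ?n" "Q \<in> carrier_mat ?n ?n" "B \<in> carrier_mat ?n ?n"
    by (auto simp: P_def Q_def B_def)
  have delta: "(\<Sum>k<m. (if k = j then f k else g k)) = (if j < m then f j - g j else 0) + (\<Sum>k<m. g k)"
    for f g :: "nat \<Rightarrow> 'a" and j
  proof -
    have "(\<Sum>k<m. (if k = j then f k else g k)) = (\<Sum>k<m. (if k = j then f k - g k else 0) + g k)"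
      by (rule sum.cong) auto
    then show ?thesis by (simp add: sum.distrib)
  qed
  have PQ: "P * Q = 1\<^sub>m ?n" and QP: "Q * P = 1\<^sub>m ?n"
    by (rule eq_matI; auto simp: P_def Q_def scalar_prod_def atLeast0LessThan less_Suc_eq
        if_distrib[of "\<lambda>x. x * _"] if_distrib[of "\<lambda>x. _ * x"] delta cong: if_cong)+
  have "A * P = P * B"
  proof (rule eq_matI)
    fix i j assume "i < dim_row (P * B)" "j < dim_col (P * B)"
    then have ij: "i < ?n" "j < ?n" using carr by auto
    have l: "(A * P) $$ (i, j) = (if j = m then A $$ (i, m) else A $$ (i, j) - A $$ (i, m))"
      using ij A by (auto simp: P_def scalar_prod_def atLeast0LessThan less_Suc_eq
          if_distrib[of "\<lambda>x. _ * x"] delta cong: if_cong)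
    have s: "(\<Sum>k<m. A $$ (k, j)) = - A $$ (m, j)" if "j < ?n" for j
      using col[OF that] by (simp add: eq_neg_iff_add_eq_0)
    have r: "(P * B) $$ (i, j) = (if i = m then - (\<Sum>k<m. B $$ (k, j)) else B $$ (i, j))"
      using ij carr by (auto simp: P_def B_def scalar_prod_def atLeast0LessThan less_Suc_eq
          if_distrib[of "\<lambda>x. x * _"] delta sum_negf cong: if_cong)
    have b: "(\<Sum>k<m. B $$ (k, j)) = (if j = m then - A $$ (m, m) else A $$ (m, m) - A $$ (m, j))"
      using ij s[of m] s[of j] by (simp add: B_def sum_subtractf)
    show "(A * P) $$ (i, j) = (P * B) $$ (i, j)"
      unfolding l r b using ij by (auto simp: B_def)
  qed (use A carr in auto)
  then have "A = P * B * Q"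
    using PQ A carr by (metis assoc_mult_mat right_mult_one_mat)
  then have "char_poly A = char_poly B"
    by (intro char_poly_similar similar_matI[of _ _ P Q ?n]) (use A carr PQ QP in auto)
  \<comment> \<open>Transposing turns the zero row of \<open>B\<close> into the zero column that
    \<open>char_poly_0_column\<close> expects.\<close>
  also have "\<dots> = char_poly (transpose_mat B)"
    using carr by (subst char_poly_transpose_mat) auto
  also have "\<dots> = monom 1 1 * char_poly (mat_delete (transpose_mat B) m m)"
    by (rule char_poly_0_column[of ?n]) (auto simp: B_def)
  also have "mat_delete (transpose_mat B) m m = transpose_mat (deflate A)"
    by (rule eq_matI) (use A in \<open>auto simp: mat_delete_def B_def deflate_def Let_def\<close>)
  also have "char_poly \<dots> = char_poly (deflate A)"
    by (rule char_poly_transpose_mat[OF deflate_carrier[OF A]])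
  finally show ?thesis by (simp add: monom_altdef)
qed

text \<open>An eigenvector of \<open>deflate A\<close> is read as coordinates in the zero-sum basis,
  which fixes the last entry of \<open>x\<close>.\<close>

lemma eigenvalue_deflate:
  fixes A :: "'a::field mat"
  assumes A: "A \<in> carrier_mat (Suc m) (Suc m)"
    and col: "\<And>j. j < Suc m \<Longrightarrow> (\<Sum>i<Suc m. A $$ (i, j)) = 0"
    and ev: "poly (char_poly (deflate A)) k = 0"
  shows "\<exists>x. (\<forall>i<Suc m. (\<Sum>j<Suc m. A $$ (i, j) * x j) = k * x i)
    \<and> (\<Sum>i<Suc m. x i) = 0 \<and> (\<exists>i<Suc m. x i \<noteq> 0)"
proof -
  note M = deflate_carrier[OF A]
  obtain v where v: "v \<in> carrier_vec m" "v \<noteq> 0\<^sub>v m" "deflate A *\<^sub>v v = k \<cdot>\<^sub>v v"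
    using ev M unfolding eigenvalue_root_char_poly[OF M, symmetric] eigenvalue_def eigenvector_def
    by auto
  define x where "x i = (if i < m then v $ i else - (\<Sum>j<m. v $ j))" for i
  have zero: "(\<Sum>i<Suc m. x i) = 0" by (simp add: x_def)
  have low: "(\<Sum>j<Suc m. A $$ (i, j) * x j) = k * x i" if i: "i < m" for i
  proof -
    have "k * x i = (deflate A *\<^sub>v v) $ i" using v i by (simp add: x_def)
    also have "\<dots> = (\<Sum>j<m. (A $$ (i, j) - A $$ (i, m)) * v $ j)"
      using A v(1) i by (simp add: deflate_def Let_def scalar_prod_def atLeast0LessThan)
    also have "\<dots> = (\<Sum>j<Suc m. A $$ (i, j) * x j)"
      by (simp add: x_def left_diff_distrib sum_subtractf sum_distrib_left)
    finally show ?thesis by simp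
  qed
  \<comment> \<open>The last row follows from the others: over all rows the left sides add up to 0
    by the zero column sums, the right sides because \<open>x\<close> sums to 0.\<close>
  have "(\<Sum>i<Suc m. \<Sum>j<Suc m. A $$ (i, j) * x j) = (\<Sum>j<Suc m. (\<Sum>i<Suc m. A $$ (i, j)) * x j)"
    unfolding sum_distrib_right by (rule sum.swap)
  also have "\<dots> = 0" using col by (intro sum.neutral) simp
  finally have "(\<Sum>j<Suc m. A $$ (m, j) * x j) = - (\<Sum>i<m. k * x i)"
    using low by (simp add: eq_neg_iff_add_eq_0 add.commute)
  also have "\<dots> = k * x m" by (simp add: x_def sum_distrib_left)
  finally have "(\<Sum>j<Suc m. A $$ (i, j) * x j) = k * x i" if "i < Suc m" for i
    using low that less_Suc_eq by metis
  moreover have "\<exists>i<Suc m. x i \<noteq> 0"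
  proof -
    obtain i where "i < m" "v $ i \<noteq> 0" using v(1,2) by force
    then show ?thesis by (auto simp: x_def intro!: exI[of _ i])
  qed
  ultimately show ?thesis using zero by blast
qed

text \<open>The Hermitian form \<open>q\<close> is real, and it is \<open>k\<close> times the
  nonzero real number \<open>?s\<close>.\<close>

lemma symmetric_eigenvalue_real:
  fixes a :: "nat \<Rightarrow> nat \<Rightarrow> real" and x :: "nat \<Rightarrow> complex"
  assumes sym: "\<And>i j. i < n \<Longrightarrow> j < n \<Longrightarrow> a i j = a j i"
    and ev: "\<And>i. i < n \<Longrightarrow> (\<Sum>j<n. of_real (a i j) * x j) = k * x i"
    and nz: "\<exists>i<n. x i \<noteq> 0"
  shows "k \<in> \<real>"
proof -
  let ?s = "\<Sum>i<n. cnj (x i) * x i"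
  define q where "q = (\<Sum>i<n. cnj (x i) * (\<Sum>j<n. of_real (a i j) * x j))"
  have q: "q = k * ?s"
    unfolding q_def by (simp add: ev sum_distrib_left mult.left_commute)
  have "cnj q = (\<Sum>i<n. \<Sum>j<n. x i * (of_real (a i j) * cnj (x j)))"
    by (simp add: q_def sum_distrib_left)
  also have "\<dots> = (\<Sum>j<n. \<Sum>i<n. x i * (of_real (a i j) * cnj (x j)))"
    by (rule sum.swap)
  also have "\<dots> = q"
    unfolding q_def sum_distrib_left by (intro sum.cong) (auto simp: sym)
  finally have "cnj k * cnj ?s = k * ?s" using q by (metis complex_cnj_mult)
  moreover have "cnj ?s = ?s" by (simp add: mult.commute)
  moreover have "?s \<noteq> 0"
  proof -
    have "?s = of_real (\<Sum>i<n. (cmod (x i))\<^sup>2)"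
      by (simp add: complex_norm_square mult.commute del: of_real_power)
    moreover have "(\<Sum>i<n. (cmod (x i))\<^sup>2) \<noteq> 0"
      using nz by (subst sum_nonneg_eq_0_iff) auto
    ultimately show ?thesis by (metis of_real_eq_0_iff)
  qed
  ultimately have "cnj k = k" by simp
  then show ?thesis by (simp add: Reals_cnj_iff)
qed

text \<open>\<open>deflate A\<close> need not be symmetric. A complex root is therefore lifted to an
  eigenvector of the symmetric matrix \<open>A\<close>, which shows that the root is real.\<close>

lemma deflate_root_exists:
  fixes A :: "real mat"
  assumes A: "A \<in> carrier_mat (Suc m) (Suc m)" and m: "0 < m"
    and sym: "\<And>i j. i < Suc m \<Longrightarrow> j < Suc m \<Longrightarrow> A $$ (i, j) = A $$ (j, i)"
    and col: "\<And>j. j < Suc m \<Longrightarrow> (\<Sum>i<Suc m. A $$ (i, j)) = 0"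
  shows "\<exists>k. poly (char_poly (deflate A)) k = 0"
proof -
  let ?A = "map_mat complex_of_real A"
  have A': "?A \<in> carrier_mat (Suc m) (Suc m)" using A by simp
  have def: "deflate ?A = map_mat of_real (deflate A)"
    by (rule eq_matI) (use A in \<open>auto simp: deflate_def Let_def\<close>)
  have cp: "char_poly (deflate ?A) = map_poly of_real (char_poly (deflate A))"
    unfolding def by (rule of_real_hom.char_poly_hom[OF deflate_carrier[OF A]])
  have "degree (char_poly (deflate ?A)) = m"
    using degree_monic_char_poly[OF deflate_carrier[OF A']] by simp
  then have "\<not> constant (poly (char_poly (deflate ?A)))"
    using m by (simp add: constant_degree)
  then obtain k where k: "poly (char_poly (deflate ?A)) k = 0"
    using fundamental_theorem_of_algebra by blast
  have "(\<Sum>i<Suc m. ?A $$ (i, j)) = 0" if "j < Suc m" for j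
  proof -
    have "(\<Sum>i<Suc m. ?A $$ (i, j)) = of_real (\<Sum>i<Suc m. A $$ (i, j))"
      unfolding of_real_sum by (rule sum.cong) (use A that in auto)
    then show ?thesis unfolding col[OF that] by simp
  qed
  then obtain x where
    x: "\<forall>i<Suc m. (\<Sum>j<Suc m. ?A $$ (i, j) * x j) = k * x i" "\<exists>i<Suc m. x i \<noteq> 0"
    using eigenvalue_deflate[OF A' _ k] by blast
  have "k \<in> \<real>"
  proof (rule symmetric_eigenvalue_real[of "Suc m" "\<lambda>i j. A $$ (i, j)" x k])
    show "(\<Sum>j<Suc m. of_real (A $$ (i, j)) * x j) = k * x i" if "i < Suc m" for i
      unfolding x(1)[rule_format, OF that, symmetric] by (rule sum.cong) (use A that in auto)
  qed (fact sym x(2))+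
  then obtain r where "k = of_real r" by (auto elim: Reals_cases)
  then show ?thesis using k cp by auto
qed

section \<open>Dirichlet energy of a graph and of its complement\<close>

text \<open>A normalised Fiedler vector. The relation \<open>R\<close> is abstract so that a graph
  and its complement are two instances.\<close>

locale fiedler =
  fixes V :: "'v set" and R :: "'v \<Rightarrow> 'v \<Rightarrow> bool" and x :: "'v \<Rightarrow> real" and l :: real and a b :: 'v
  assumes finite_V: "finite V"
    and sym: "\<And>u v. R u v \<Longrightarrow> R v u"
    and irrefl: "\<And>v. \<not> R v v"
    and eigen: "\<And>v. v \<in> V \<Longrightarrow> (\<Sum>u\<in>V. if R v u then x v - x u else 0) = l * x v"
    and sum_zero: "(\<Sum>v\<in>V. x v) = 0"
    and extremes: "a \<in> V" "b \<in> V" "\<And>v. v \<in> V \<Longrightarrow> x v \<le> x a" "\<And>v. v \<in> V \<Longrightarrow> x b \<le> x v"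
    and width: "x a - x b = 1"
    and small: "l < 2 / 5"
begin

lemma pos: "0 < x a" and neg: "x b < 0"
proof -
  have "\<exists>v\<in>V. 0 < x v"
  proof (rule ccontr)
    assume "\<not> ?thesis"
    then have "(\<Sum>v\<in>V. - x v) = 0 \<longleftrightarrow> (\<forall>v\<in>V. - x v = 0)"
      by (intro sum_nonneg_eq_0_iff finite_V) auto
    then have "\<forall>v\<in>V. x v = 0" using sum_zero by (simp add: sum_negf)
    then show False using extremes(1,2) width by simp
  qed
  then show "0 < x a" using extremes(3) by force
  have "\<exists>v\<in>V. x v < 0"
  proof (rule ccontr)
    assume "\<not> ?thesis"
    then have "(\<Sum>v\<in>V. x v) = 0 \<longleftrightarrow> (\<forall>v\<in>V. x v = 0)"
      by (intro sum_nonneg_eq_0_iff finite_V) auto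
    then have "\<forall>v\<in>V. x v = 0" using sum_zero by simp
    then show False using extremes(1,2) width by simp
  qed
  then show "x b < 0" using extremes(4) by force
qed

text \<open>Exchanges maximum and minimum: claims at \<open>b\<close> follow from those at
  \<open>a\<close>, and later \<open>c\<close> and \<open>d\<close> can be swapped.\<close>

lemma negate: "fiedler V R (\<lambda>v. - x v) l b a"
proof
  show "(\<Sum>u\<in>V. if R v u then - x v - - x u else 0) = l * - x v" if "v \<in> V" for v
  proof -
    have "(\<Sum>u\<in>V. if R v u then - x v - - x u else 0) = - (\<Sum>u\<in>V. if R v u then x v - x u else 0)"
      unfolding sum_negf[symmetric] by (rule sum.cong) auto
    then show ?thesis using eigen[OF that] by simp
  qed
qed (use finite_V sym irrefl sum_zero extremes width small in \<open>auto simp: sum_negf\<close>)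

text \<open>The eigenvalue equation at the maximum: the deficits of the neighbours add up to \<open>l * x a\<close>.\<close>

lemma neighbour_max:
  assumes "v \<in> V" "R a v"
  shows "x a - x v \<le> l * x a"
proof -
  have "(if R a v then x a - x v else 0) \<le> (\<Sum>u\<in>V. if R a u then x a - x u else 0)"
    by (rule member_le_sum) (use assms finite_V extremes in auto)
  then show ?thesis using eigen[OF extremes(1)] assms by simp
qed

lemma neighbour_min:
  assumes "v \<in> V" "R b v"
  shows "x v - x b \<le> l * - x b"
  using fiedler.neighbour_max[OF negate assms] by simp

lemma eigenvalue_nonneg: "0 \<le> l"
proof -
  have "0 \<le> (\<Sum>u\<in>V. if R a u then x a - x u else 0)"
    by (rule sum_nonneg) (use extremes in auto)
  then show ?thesis using eigen[OF extremes(1)] pos by (simp add: zero_le_mult_iff)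
qed

text \<open>As \<open>l < 1\<close>, the deficit of a neighbour of \<open>a\<close> is below
  \<open>x a\<close>, so its value stays positive; dually at \<open>b\<close>.\<close>

lemma neighbour_signs:
  assumes "v \<in> V"
  shows "R a v \<Longrightarrow> 0 < x v" "R b v \<Longrightarrow> x v < 0"
proof -
  have "l * x a < x a" using pos small by simp
  then show "R a v \<Longrightarrow> 0 < x v" using neighbour_max[OF assms] by linarith
  have "l * - x b < - x b" using neg small by (simp del: mult_minus_right)
  then show "R b v \<Longrightarrow> x v < 0" using neighbour_min[OF assms] by linarith
qed

lemma extremes_nonadjacent: "\<not> R a b"
  using neighbour_signs(1)[OF extremes(2)] neg by auto

lemma no_common_neighbour: "v \<in> V \<Longrightarrow> R a v \<Longrightarrow> \<not> R b v"
  using neighbour_signs[of v] by auto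

lemma extremes_distinct: "a \<noteq> b"
  using width by auto

definition edge :: "'v \<Rightarrow> 'v \<Rightarrow> real" where
  "edge u v = (if R u v then (x u - x v)\<^sup>2 else 0)"

text \<open>The local defect in the bound of the square norm by \<open>card V * (x a * - x b)\<close>.\<close>

definition slack :: "'v \<Rightarrow> real" where
  "slack v = l * ((x a - x v) * (x v - x b))"

lemma edge_nonneg: "0 \<le> edge u v"
  by (simp add: edge_def)

lemma edge_commute: "edge u v = edge v u"
  using sym by (auto simp: edge_def power2_commute)

lemma slack_nonneg: "v \<in> V \<Longrightarrow> 0 \<le> slack v"
  using eigenvalue_nonneg extremes by (simp add: slack_def)

text \<open>Summation by parts for the Dirichlet form. The double sum meets each edge twice, hence
  the factor 2.\<close>

lemma energy: "(\<Sum>v\<in>V. \<Sum>u\<in>V. edge v u) = 2 * (l * (\<Sum>v\<in>V. (x v)\<^sup>2))"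
proof -
  let ?f = "\<lambda>v u. if R v u then x v * (x v - x u) else 0"
  have 1: "(\<Sum>v\<in>V. \<Sum>u\<in>V. ?f v u) = l * (\<Sum>v\<in>V. (x v)\<^sup>2)"
  proof -
    have "(\<Sum>u\<in>V. ?f v u) = l * (x v)\<^sup>2" if "v \<in> V" for v
    proof -
      have "(\<Sum>u\<in>V. ?f v u) = x v * (\<Sum>u\<in>V. if R v u then x v - x u else 0)"
        unfolding sum_distrib_left by (rule sum.cong) auto
      then show ?thesis using eigen[OF that] by (simp add: power2_eq_square)
    qed
    then show ?thesis by (simp add: sum_distrib_left)
  qed
  have "edge v u = ?f v u + ?f u v" for v u
    using sym by (auto simp: edge_def power2_eq_square algebra_simps)
  then have "(\<Sum>v\<in>V. \<Sum>u\<in>V. edge v u) = (\<Sum>v\<in>V. \<Sum>u\<in>V. ?f v u) + (\<Sum>v\<in>V. \<Sum>u\<in>V. ?f u v)"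
    by (simp add: sum.distrib)
  also have "(\<Sum>v\<in>V. \<Sum>u\<in>V. ?f u v) = (\<Sum>v\<in>V. \<Sum>u\<in>V. ?f v u)"
    by (rule sum.swap)
  finally show ?thesis using 1 by simp
qed

text \<open>Expanding \<open>slack v\<close> gives a constant, a linear term that vanishes on
  summation, and \<open>- l * (x v)\<^sup>2\<close>.\<close>

lemma sum_squares: "l * (\<Sum>v\<in>V. (x v)\<^sup>2) = l * (card V * (x a * - x b)) - (\<Sum>v\<in>V. slack v)"
proof -
  have "slack v = l * (x a * - x b) + (l * (x a + x b)) * x v - l * (x v)\<^sup>2" for v
    by (simp add: slack_def power2_eq_square algebra_simps)
  then have "(\<Sum>v\<in>V. slack v) = card V * (l * (x a * - x b)) + (l * (x a + x b)) * (\<Sum>v\<in>V. x v)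
      - l * (\<Sum>v\<in>V. (x v)\<^sup>2)"
    by (simp add: sum.distrib sum_subtractf sum_distrib_left)
  then show ?thesis using sum_zero by simp
qed

lemma sum_split_pair:
  fixes f :: "'v \<Rightarrow> real"
  assumes "p \<in> V" "q \<in> V" "p \<noteq> q"
  shows "sum f V = f p + f q + sum f (V - {p, q})"
proof -
  have "sum f V = sum f {p, q} + sum f (V - {p, q})"
    using assms finite_V by (simp add: sum.subset_diff[of "{p,q}" V f])
  then show ?thesis using assms by simp
qed

lemma amplitude: "x a * - x b \<le> 1 / 4"
proof -
  have "x b = x a - 1" using width by simp
  then have "x a * - x b = x a * (1 - x a)" by simp
  also have "\<dots> = 1 / 4 - (x a - 1 / 2)\<^sup>2"
    by (simp add: power2_eq_square field_simps)
  finally have "x a * - x b = 1 / 4 - (x a - 1 / 2)\<^sup>2" .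
  then show ?thesis by simp
qed

definition cost :: "'v \<Rightarrow> 'v \<Rightarrow> 'v \<Rightarrow> real" where
  "cost p q v = edge v p + edge v q + slack v"

lemma cost_nonneg: "v \<in> V \<Longrightarrow> 0 \<le> cost p q v"
  using slack_nonneg edge_nonneg by (simp add: cost_def)

text \<open>Only edges meeting \<open>{p, q}\<close> are kept, and the defects move over from the
  norm identity. \<open>W\<close> permits dropping further vertices, whose costs are
  nonnegative.\<close>

lemma energy_bound:
  assumes pq: "p \<in> V" "q \<in> V" "R p q" and W: "W \<subseteq> V - {p, q}"
  shows "edge p q + slack p + slack q + (\<Sum>v\<in>W. cost p q v) \<le> l * (card V * (x a * - x b))"
proof -
  have ne: "p \<noteq> q" using pq irrefl by auto
  let ?W = "V - {p, q}"
  have row: "(\<Sum>u\<in>V. edge v u) = edge v p + edge v q + (\<Sum>u\<in>?W. edge v u)" for v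
    by (rule sum_split_pair[OF pq(1,2) ne])
  have "(\<Sum>v\<in>V. \<Sum>u\<in>V. edge v u)
      = (\<Sum>u\<in>V. edge p u) + (\<Sum>u\<in>V. edge q u) + (\<Sum>v\<in>?W. \<Sum>u\<in>V. edge v u)"
    by (rule sum_split_pair[OF pq(1,2) ne])
  also have "\<dots> = 2 * edge p q + 2 * (\<Sum>v\<in>?W. edge v p + edge v q) + (\<Sum>v\<in>?W. \<Sum>u\<in>?W. edge v u)"
  proof -
    have loops: "edge p p = 0" "edge q q = 0" by (simp_all add: edge_def irrefl)
    have cols: "(\<Sum>v\<in>?W. edge p v) = (\<Sum>v\<in>?W. edge v p)"
      "(\<Sum>v\<in>?W. edge q v) = (\<Sum>v\<in>?W. edge v q)"
      by (rule sum.cong; simp only: edge_commute)+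
    show ?thesis
      unfolding row sum.distrib loops cols edge_commute[of q p] by (simp add: algebra_simps)
  qed
  also have "\<dots> \<ge> 2 * edge p q + 2 * (\<Sum>v\<in>?W. edge v p + edge v q)"
    using sum_nonneg[of ?W "\<lambda>v. \<Sum>u\<in>?W. edge v u"] edge_nonneg by (simp add: sum_nonneg)
  finally have "edge p q + (\<Sum>v\<in>?W. edge v p + edge v q) \<le> l * (\<Sum>v\<in>V. (x v)\<^sup>2)"
    using energy by simp
  moreover have "(\<Sum>v\<in>V. slack v) = slack p + slack q + (\<Sum>v\<in>?W. slack v)"
    by (rule sum_split_pair[OF pq(1,2) ne])
  ultimately have "edge p q + slack p + slack q + (\<Sum>v\<in>?W. cost p q v) \<le> l * (card V * (x a * - x b))"
    using sum_squares by (simp add: cost_def sum.distrib)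
  moreover have "(\<Sum>v\<in>W. cost p q v) \<le> (\<Sum>v\<in>?W. cost p q v)"
    by (rule sum_mono2) (use finite_V W cost_nonneg in auto)
  ultimately show ?thesis by simp
qed

end

section \<open>Two numerical inequalities\<close>

text \<open>With \<open>d = s + t\<close> and \<open>l\<close> lowered to \<open>d\<close>, the
  right side is at least \<open>(1 - d) * (1 - d + d\<^sup>2)\<close>, hence at least 3/5 * 3/4 =
  9/20.\<close>

lemma deficit_edge_bound:
  fixes l s t :: real
  assumes "0 \<le> s" "0 \<le> t" "s + t \<le> l" "l < 2 / 5"
  shows "2 / 5 \<le> (1 - s - t)\<^sup>2 + l * (s * (1 - s)) + l * (t * (1 - t))"
proof -
  define d where "d = s + t"
  have d: "0 \<le> d" "d < 2 / 5" using assms by (auto simp: d_def)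
  have "s\<^sup>2 + t\<^sup>2 \<le> d\<^sup>2" using assms by (simp add: d_def power2_eq_square algebra_simps)
  then have "d * (1 - d) \<le> s * (1 - s) + t * (1 - t)"
    by (simp add: d_def power2_eq_square algebra_simps)
  moreover have "d * (d * (1 - d)) \<le> l * (d * (1 - d))"
    using assms d by (intro mult_right_mono) (auto simp: d_def)
  moreover have "l * (d * (1 - d)) \<le> l * (s * (1 - s) + t * (1 - t))"
    using calculation(1) assms by (intro mult_left_mono) auto
  moreover have "(3 / 5) * (3 / 4) \<le> (1 - d) * (1 - d + d\<^sup>2)"
  proof (rule mult_mono)
    have "0 \<le> (d - 1 / 2)\<^sup>2" by simp
    then show "3 / 4 \<le> 1 - d + d\<^sup>2" by (simp add: power2_eq_square algebra_simps)
  qed (use d in auto)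
  moreover have "(1 - d) * (1 - d + d\<^sup>2) = (1 - s - t)\<^sup>2 + d * (d * (1 - d))"
    by (simp add: d_def power2_eq_square algebra_simps)
  ultimately show ?thesis by (simp add: algebra_simps)
qed

text \<open>\<open>z - e\<close> is the offset of \<open>r\<close> from the midpoint of
  \<open>s\<close> and \<open>1 - t\<close>. Completing the square leaves a main term of at least
  7/25 and an error of at most 4/125.\<close>

lemma deficit_vertex_bound:
  fixes l s t r :: real
  assumes "0 \<le> s" "0 \<le> t" "s + t \<le> l" "l < 2 / 5" "0 \<le> r" "r \<le> 1"
  shows "1 / 5 \<le> (r - s)\<^sup>2 + (1 - t - r)\<^sup>2 + l * (r * (1 - r))"
proof -
  define d e z where "d = s + t" and "e = (s - t) / 2" and "z = r - 1 / 2"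
  have d: "0 \<le> d" "d < 2 / 5" using assms by (auto simp: d_def)
  have "d * (r * (1 - r)) \<le> l * (r * (1 - r))"
    using assms by (intro mult_right_mono) (auto simp: d_def)
  moreover have "(r - s)\<^sup>2 + (1 - t - r)\<^sup>2 + d * (r * (1 - r))
      = 2 * (z - e)\<^sup>2 + (1 - d)\<^sup>2 / 2 + d / 4 - d * z\<^sup>2"
    by (simp add: d_def e_def z_def power2_eq_square field_simps)
  moreover have "d * z\<^sup>2 \<le> 2 * (z - e)\<^sup>2 + 2 * d * e\<^sup>2"
  proof -
    have "z\<^sup>2 \<le> 2 * (z - e)\<^sup>2 + 2 * e\<^sup>2"
      using zero_le_power2[of "z - 2 * e"] by (simp add: power2_eq_square algebra_simps)
    then have "d * z\<^sup>2 \<le> d * (2 * (z - e)\<^sup>2 + 2 * e\<^sup>2)"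
      using d by (intro mult_left_mono) auto
    also have "\<dots> \<le> 1 * (2 * (z - e)\<^sup>2) + d * (2 * e\<^sup>2)"
      using d mult_right_mono[of d 1 "2 * (z - e)\<^sup>2"] by (simp add: distrib_left)
    finally show ?thesis by simp
  qed
  moreover have "2 * d * e\<^sup>2 \<le> 4 / 125"
  proof -
    have "e = s / 2 - t / 2" by (simp add: e_def diff_divide_distrib)
    then have "\<bar>e\<bar> \<le> 1 / 5" using assms by linarith
    then have "e\<^sup>2 \<le> (1 / 5)\<^sup>2" by (metis abs_ge_zero power2_abs power_mono)
    then have "(2 * d) * e\<^sup>2 \<le> (4 / 5) * (1 / 5)\<^sup>2" using d by (intro mult_mono) auto
    then show ?thesis by (simp add: power2_eq_square)
  qed
  moreover have "7 / 25 \<le> (1 - d)\<^sup>2 / 2 + d / 4"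
  proof -
    \<comment> \<open>The doubled difference of the two sides has the roots 2/5 and 11/10.\<close>
    have "0 \<le> (2 / 5 - d) * (11 / 10 - d)" using d by simp
    then show ?thesis by (simp add: power2_eq_square field_simps)
  qed
  ultimately show ?thesis by simp
qed

section \<open>Energy near the inner vertices of the path\<close>

context fiedler
begin

text \<open>\<open>p\<close> and \<open>q\<close> are the inner vertices of a path \<open>a\<close>,
  \<open>p\<close>, \<open>q\<close>, \<open>b\<close>. Their deficits become \<open>s\<close> and
  \<open>t\<close> in the inequalities above.\<close>

context
  fixes p q
  assumes pq: "p \<in> V" "q \<in> V" "R a p" "R b q"
begin

lemma pq_deficits:
  "0 \<le> x a - x p" "0 \<le> x q - x b" "(x a - x p) + (x q - x b) \<le> l"
proof -
  have "l * x a + l * - x b = l" using width by (simp flip: right_diff_distrib)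
  then show "(x a - x p) + (x q - x b) \<le> l"
    using neighbour_max[OF pq(1,3)] neighbour_min[OF pq(2,4)] by linarith
qed (use extremes pq in auto)

lemma bridge_cost:
  assumes "R p q"
  shows "2 / 5 \<le> edge p q + slack p + slack q"
proof -
  define s t where "s = x a - x p" and "t = x q - x b"
  have "2 / 5 \<le> (1 - s - t)\<^sup>2 + l * (s * (1 - s)) + l * (t * (1 - t))"
    using deficit_edge_bound[of s t l] pq_deficits small by (simp add: s_def t_def)
  moreover have "edge p q + slack p + slack q
      = (1 - s - t)\<^sup>2 + l * (s * (1 - s)) + l * (t * (1 - t))"
  proof -
    have eqs: "x p - x q = 1 - s - t" "x a - x p = s" "x p - x b = 1 - s"
      "x a - x q = 1 - t" "x q - x b = t"
      using width by (auto simp: s_def t_def)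
    show ?thesis unfolding edge_def slack_def eqs using assms by (simp add: mult.commute)
  qed
  ultimately show ?thesis by simp
qed

lemma cost_common_neighbour:
  assumes "v \<in> V" "R p v" "R q v"
  shows "1 / 5 \<le> cost p q v"
proof -
  define s t r where "s = x a - x p" and "t = x q - x b" and "r = x a - x v"
  have r: "0 \<le> r" "r \<le> 1" using extremes(3,4)[OF assms(1)] width by (auto simp: r_def)
  have "1 / 5 \<le> (r - s)\<^sup>2 + (1 - t - r)\<^sup>2 + l * (r * (1 - r))"
    using deficit_vertex_bound[of s t l r] pq_deficits small r by (simp add: s_def t_def)
  moreover have "cost p q v = (r - s)\<^sup>2 + (1 - t - r)\<^sup>2 + l * (r * (1 - r))"
  proof -
    have eqs: "x v - x p = s - r" "x v - x q = 1 - t - r" "x a - x v = r" "x v - x b = 1 - r"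
      using width by (auto simp: s_def t_def r_def)
    show ?thesis unfolding cost_def edge_def slack_def eqs using assms sym[of p v] sym[of q v]
      by (simp add: power2_commute[of r s])
  qed
  ultimately show ?thesis by simp
qed

text \<open>An edge from a neighbour of \<open>a\<close> to a neighbour of \<open>b\<close> spans at
  least \<open>1 - l\<close>, which exceeds 3/5, and 9/25 is more than 1/5.\<close>

lemma cost_opposite:
  assumes "v \<in> V" "R a v \<and> R q v \<or> R b v \<and> R p v"
  shows "1 / 5 \<le> cost p q v"
proof -
  have gap: "(1 / 5 :: real) \<le> (x u - x w)\<^sup>2" if "u \<in> V" "w \<in> V" "R a u" "R b w" for u w
  proof -
    have "x u - x w = 1 - (x a - x u) - (x w - x b)" using width by simp
    also have "\<dots> \<ge> 1 - (l * x a + l * - x b)"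
      using neighbour_max[OF that(1,3)] neighbour_min[OF that(2,4)] by linarith
    also have "l * x a + l * - x b = l" using width by (simp flip: right_diff_distrib)
    finally have "3 / 5 \<le> x u - x w" using small by simp
    then have "(3 / 5)\<^sup>2 \<le> (x u - x w)\<^sup>2" by (intro power_mono) auto
    then show ?thesis by (simp add: power2_eq_square)
  qed
  have "1 / 5 \<le> edge v p + edge v q"
    using assms(2)
  proof
    assume "R a v \<and> R q v"
    then have "1 / 5 \<le> edge v q" using gap[of v q] assms pq sym by (auto simp: edge_def)
    then show ?thesis using edge_nonneg[of v p] by linarith
  next
    assume "R b v \<and> R p v"
    then have "1 / 5 \<le> edge v p" using gap[of p v] assms pq sym by (auto simp: edge_def power2_commute)
    then show ?thesis using edge_nonneg[of v q] by linarith
  qed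
  then show ?thesis using slack_nonneg[OF assms(1)] by (simp add: cost_def)
qed

end

lemma energy_upper: "V \<noteq> {} \<Longrightarrow> l * (card V * (x a * - x b)) < card V / 10"
proof -
  assume "V \<noteq> {}"
  then have n: "0 < real (card V)" using finite_V by (simp add: card_gt_0_iff)
  have "l * (card V * (x a * - x b)) \<le> l * (card V * (1 / 4))"
    using amplitude eigenvalue_nonneg by (intro mult_left_mono) auto
  also have "\<dots> < (2 / 5) * (card V * (1 / 4))"
    using small n by (intro mult_strict_right_mono) auto
  finally show ?thesis by simp
qed

end

section \<open>Contradiction from two small eigenvalues\<close>

text \<open>The complement of the path \<open>a\<close>, \<open>c\<close>, \<open>d\<close>,
  \<open>b\<close> is the path \<open>c\<close>, \<open>b\<close>, \<open>a\<close>,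
  \<open>d\<close>. So the estimates apply to \<open>x\<close> with inner pair \<open>c\<close>,
  \<open>d\<close> and to \<open>y\<close> with inner pair \<open>b\<close>, \<open>a\<close>. They
  total at least 4/5 + \<open>card W / 5\<close>, which is \<open>card V / 5\<close>, against two
  strict bounds by \<open>card V / 10\<close>.\<close>

lemma no_fiedler_pair_linked:
  assumes x: "fiedler V R x l a b" and y: "fiedler V (\<lambda>u v. u \<noteq> v \<and> \<not> R u v) y m c d"
    and ac: "R a c"
  shows False
proof -
  interpret x: fiedler V R x l a b by fact
  interpret y: fiedler V "\<lambda>u v. u \<noteq> v \<and> \<not> R u v" y m c d by fact
  note mem = x.extremes(1,2) y.extremes(1,2)
  have ab: "\<not> R a b" "a \<noteq> b" by (fact x.extremes_nonadjacent x.extremes_distinct)+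
  have cd: "R c d" "c \<noteq> d" using y.extremes_nonadjacent y.extremes_distinct by auto
  have bc: "\<not> R b c" using x.no_common_neighbour[OF mem(3) ac] .
  have ne: "a \<noteq> c" "b \<noteq> c" "b \<noteq> d"
    using ac x.irrefl ab cd x.sym bc by blast+
  have bd: "R b d"
    using y.no_common_neighbour[OF mem(2)] bc ne x.sym by blast
  have ne: "a \<noteq> c" "b \<noteq> c" "b \<noteq> d" "a \<noteq> d"
    using ne bd ab x.sym by blast+
  have ad: "\<not> R a d" using x.no_common_neighbour[OF mem(4)] bd by auto
  have nonadj: "c \<noteq> b \<and> \<not> R c b" "d \<noteq> a \<and> \<not> R d a" "b \<noteq> a \<and> \<not> R b a"
    using ad bc ab ne x.sym by blast+
  define W where "W = V - {a, b, c, d}"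
  have W: "W \<subseteq> V - {c, d}" "W \<subseteq> V - {b, a}" by (auto simp: W_def)
  have cardW: "real (card V) = card W + 4"
  proof -
    have "card {a, b, c, d} = 4" using ne ab cd by simp
    moreover have "card W = card V - card {a, b, c, d}"
      unfolding W_def using mem by (intro card_Diff_subset) auto
    moreover have "card {a, b, c, d} \<le> card V"
      using mem by (intro card_mono x.finite_V) auto
    ultimately show ?thesis by simp
  qed
  have vertex: "1 / 5 \<le> x.cost c d v + y.cost b a v" if "v \<in> W" for v
  proof -
    have v: "v \<in> V" "v \<noteq> a" "v \<noteq> b" "v \<noteq> c" "v \<noteq> d" using that by (auto simp: W_def)
    have nn: "0 \<le> x.cost c d v" "0 \<le> y.cost b a v" using v x.cost_nonneg y.cost_nonneg by auto
    have "R c v \<or> R d v" using y.no_common_neighbour[OF v(1)] v by auto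
    moreover have "\<not> (R a v \<and> R b v)" using x.no_common_neighbour[OF v(1)] by auto
    \<comment> \<open>Beyond the first two cases, \<open>v\<close> has exactly one neighbour in each
      of \<open>{a, b}\<close> and \<open>{c, d}\<close>. If these are \<open>a\<close>,
      \<open>d\<close> or \<open>b\<close>, \<open>c\<close>, case 3 applies; otherwise its two
      non-neighbours give case 4.\<close>
    ultimately consider "R c v \<and> R d v" | "\<not> R a v \<and> \<not> R b v"
      | "R a v \<and> R d v \<or> R b v \<and> R c v"
      | "\<not> R c v \<and> \<not> R a v \<or> \<not> R d v \<and> \<not> R b v"
      by auto
    then show ?thesis
    proof cases
      case 1
      then have "1 / 5 \<le> x.cost c d v"
        by (intro x.cost_common_neighbour mem v(1) ac bd) auto
      then show ?thesis using nn by simp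
    next
      case 2
      then have "1 / 5 \<le> y.cost b a v"
        by (intro y.cost_common_neighbour nonadj mem v(1)) (use v in auto)
      then show ?thesis using nn by simp
    next
      case 3
      then have "1 / 5 \<le> x.cost c d v"
        by (intro x.cost_opposite mem v(1) ac bd) auto
      then show ?thesis using nn by simp
    next
      case 4
      then have "1 / 5 \<le> y.cost b a v"
        by (intro y.cost_opposite nonadj mem v(1)) (use v in auto)
      then show ?thesis using nn by simp
    qed
  qed
  have nonempty: "V \<noteq> {}" using mem by auto
  have "x.edge c d + x.slack c + x.slack d + (\<Sum>v\<in>W. x.cost c d v) < card V / 10"
    using x.energy_bound[OF mem(3,4) cd(1) W(1)] x.energy_upper[OF nonempty] by linarith
  moreover have "2 / 5 \<le> x.edge c d + x.slack c + x.slack d"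
    by (rule x.bridge_cost[OF mem(3,4) ac bd cd(1)])
  moreover have "y.edge b a + y.slack b + y.slack a + (\<Sum>v\<in>W. y.cost b a v) < card V / 10"
    using y.energy_bound[OF mem(2,1) nonadj(3) W(2)] y.energy_upper[OF nonempty] by linarith
  moreover have "2 / 5 \<le> y.edge b a + y.slack b + y.slack a"
    by (rule y.bridge_cost[OF mem(2,1) nonadj])
  moreover have "card W / 5 \<le> (\<Sum>v\<in>W. x.cost c d v) + (\<Sum>v\<in>W. y.cost b a v)"
    using sum_bounded_below[of W "1 / 5" "\<lambda>v. x.cost c d v + y.cost b a v"] vertex
    by (simp add: sum.distrib)
  ultimately show False using cardW by simp
qed

text \<open>\<open>c\<close> and \<open>d\<close> are adjacent and have no common non-neighbour
  outside \<open>{c, d}\<close>, so \<open>a\<close> is adjacent to one of them; negating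
  \<open>y\<close> swaps the two.\<close>

lemma no_fiedler_pair:
  assumes x: "fiedler V R x l a b" and y: "fiedler V (\<lambda>u v. u \<noteq> v \<and> \<not> R u v) y m c d"
  shows False
proof (cases "R a c")
  case True
  then show False using no_fiedler_pair_linked[OF x y] by simp
next
  case False
  interpret x: fiedler V R x l a b by fact
  interpret y: fiedler V "\<lambda>u v. u \<noteq> v \<and> \<not> R u v" y m c d by fact
  have "R c d" using y.extremes_nonadjacent y.extremes_distinct by auto
  show False
  proof (cases "a = c \<or> a = d")
    case True
    then have "R a d" using \<open>R c d\<close> x.sym \<open>\<not> R a c\<close> by auto
    then show False using no_fiedler_pair_linked[OF x fiedler.negate[OF y]] by simp
  next
    case False
    then have "R a d" using y.no_common_neighbour[OF x.extremes(1)] x.sym \<open>\<not> R a c\<close> by auto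
    then show False using no_fiedler_pair_linked[OF x fiedler.negate[OF y]] by simp
  qed
qed

section \<open>The second Laplacian eigenvalue\<close>

text \<open>The polynomial is X times that of \<open>deflate A\<close>, whose roots are nonnegative.
  So the sorted list starts with the split-off 0, and index 1 holds the least root of the second
  factor.\<close>

lemma second_root:
  fixes A :: "real mat"
  assumes A: "A \<in> carrier_mat (Suc m) (Suc m)" and m: "0 < m"
    and sym: "\<And>i j. i < Suc m \<Longrightarrow> j < Suc m \<Longrightarrow> A $$ (i, j) = A $$ (j, i)"
    and col: "\<And>j. j < Suc m \<Longrightarrow> (\<Sum>i<Suc m. A $$ (i, j)) = 0"
    and nonneg: "\<And>k. poly (char_poly (deflate A)) k = 0 \<Longrightarrow> 0 \<le> k"
  shows "poly (char_poly (deflate A)) (sorted_list_of_multiset (proots (char_poly A)) ! 1) = 0"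
proof -
  let ?p = "char_poly (deflate A)"
  have nz: "?p \<noteq> 0" using degree_monic_char_poly[OF deflate_carrier[OF A]] by auto
  let ?r = "sorted_list_of_multiset (proots ?p)"
  have roots: "set ?r = {k. poly ?p k = 0}" using nz by simp
  have "proots (char_poly A) = add_mset 0 (proots ?p)"
  proof -
    have "char_poly A = [:0, 1:] * ?p" by (rule char_poly_deflate[OF A col])
    then show ?thesis using nz by (simp add: proots_mult del: mult_pCons_left)
  qed
  then have "sorted_list_of_multiset (proots (char_poly A)) = List.insort 0 ?r"
    by simp
  also have "\<dots> = 0 # ?r"
    by (rule insort_is_Cons) (use roots nonneg in auto)
  finally have "sorted_list_of_multiset (proots (char_poly A)) ! 1 = ?r ! 0" by simp
  \<comment> \<open>The list must be nonempty for \<open>! 0\<close> to denote a root.\<close>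
  moreover have "?r ! 0 \<in> set ?r"
  proof (rule nth_mem)
    obtain k where "k \<in> set ?r" unfolding roots using deflate_root_exists[OF A m sym col] by auto
    then show "0 < length ?r" by (rule length_pos_if_in_set)
  qed
  ultimately show ?thesis unfolding roots by simp
qed

text \<open>At a vertex \<open>a\<close> of maximal absolute value, every term of the equation times
  \<open>x a\<close> is nonnegative.\<close>

lemma difference_eigenvalue_nonneg:
  fixes x :: "'v \<Rightarrow> real"
  assumes fin: "finite V"
    and eigen: "\<And>v. v \<in> V \<Longrightarrow> (\<Sum>u\<in>V. if R v u then x v - x u else 0) = k * x v"
    and nz: "w \<in> V" "x w \<noteq> 0"
  shows "0 \<le> k"
proof -
  have "Max ((\<lambda>v. \<bar>x v\<bar>) ` V) \<in> (\<lambda>v. \<bar>x v\<bar>) ` V" using fin nz by (intro Max_in) auto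
  then obtain a where a: "a \<in> V" "Max ((\<lambda>v. \<bar>x v\<bar>) ` V) = \<bar>x a\<bar>" by auto
  then have max: "\<bar>x v\<bar> \<le> \<bar>x a\<bar>" if "v \<in> V" for v
    using fin that by (metis Max_ge finite_imageI imageI)
  then have pos: "0 < x a * x a" using nz by (force simp: zero_less_mult_iff)
  have "0 \<le> x a * (x a - x v)" if "v \<in> V" for v
  proof -
    have "x a * x v \<le> \<bar>x a\<bar> * \<bar>x v\<bar>" by (metis abs_ge_self abs_mult)
    also have "\<dots> \<le> \<bar>x a\<bar> * \<bar>x a\<bar>" using max[OF that] by (intro mult_left_mono) auto
    finally show ?thesis by (simp add: right_diff_distrib)
  qed
  then have "0 \<le> (\<Sum>u\<in>V. x a * (if R a u then x a - x u else 0))"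
    by (intro sum_nonneg) auto
  also have "\<dots> = k * (x a * x a)"
    using eigen[OF a(1)] by (simp flip: sum_distrib_left)
  finally show ?thesis using pos by (simp add: zero_le_mult_iff)
qed

text \<open>Dividing by the width \<open>w\<close> normalises \<open>x\<close>; \<open>w\<close> is
  positive because a constant vector with sum 0 vanishes.\<close>

lemma fiedler_exists:
  fixes x :: "'v \<Rightarrow> real"
  assumes fin: "finite V" and sym: "\<And>u v. R u v \<Longrightarrow> R v u" and irrefl: "\<And>v. \<not> R v v"
    and eigen: "\<And>v. v \<in> V \<Longrightarrow> (\<Sum>u\<in>V. if R v u then x v - x u else 0) = l * x v"
    and zero: "(\<Sum>v\<in>V. x v) = 0" and nz: "\<exists>v\<in>V. x v \<noteq> 0" and small: "l < 2 / 5"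
  shows "\<exists>y a b. fiedler V R y l a b"
proof -
  have ne: "x ` V \<noteq> {}" using nz by auto
  obtain a where a: "a \<in> V" "x a = Max (x ` V)"
    using Max_in[OF finite_imageI[OF fin] ne] by (metis imageE)
  obtain b where b: "b \<in> V" "x b = Min (x ` V)"
    using Min_in[OF finite_imageI[OF fin] ne] by (metis imageE)
  have le: "x v \<le> x a" "x b \<le> x v" if "v \<in> V" for v
    using a b fin that by auto
  define w where "w = x a - x b"
  have w: "0 < w"
  proof (rule ccontr)
    assume "\<not> ?thesis"
    then have const: "x v = x a" if "v \<in> V" for v using le[OF that] by (simp add: w_def)
    then have "card V * x a = 0" using zero by simp
    then show False using nz const fin by auto
  qed
  have "fiedler V R (\<lambda>v. x v / w) l a b"
  proof
    show "(\<Sum>u\<in>V. if R v u then x v / w - x u / w else 0) = l * (x v / w)" if "v \<in> V" for v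
    proof -
      have "(\<Sum>u\<in>V. if R v u then x v / w - x u / w else 0) = (\<Sum>u\<in>V. if R v u then x v - x u else 0) / w"
        unfolding sum_divide_distrib by (rule sum.cong) (auto simp: diff_divide_distrib)
      then show ?thesis using eigen[OF that] by simp
    qed
    show "(\<Sum>v\<in>V. x v / w) = 0" using zero by (simp flip: sum_divide_distrib)
    show "x a / w - x b / w = 1" using w by (simp add: w_def flip: diff_divide_distrib)
  qed (use a b le w fin sym irrefl small in \<open>auto simp: divide_right_mono\<close>)
  then show ?thesis by blast
qed

section \<open>From the Laplacian matrix to sums over neighbours\<close>

text \<open>Stated on indices, so that the matrix indices can serve as the vertex set of
  \<open>fiedler\<close>.\<close>

definition adjacent :: "'a pair_pre_digraph \<Rightarrow> nat \<Rightarrow> nat \<Rightarrow> bool" where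
  "adjacent G i j \<longleftrightarrow> (vertex_list G ! i, vertex_list G ! j) \<in> parcs G"

lemma out_degree_vertex_list:
  assumes "pair_graph G" "i < card (pverts G)"
  shows "real (out_degree (with_proj G) (vertex_list G ! i))
    = (\<Sum>j<card (pverts G). if adjacent G i j then 1 else 0)"
proof -
  interpret pair_graph G by fact
  note vl = vertex_list[OF pair_finite_verts]
  let ?n = "card (pverts G)" and ?v = "vertex_list G ! i"
  have "out_arcs (with_proj G) ?v = (\<lambda>j. (?v, vertex_list G ! j)) ` {j. j < ?n \<and> adjacent G i j}"
  proof (intro equalityI subsetI)
    fix e assume e: "e \<in> out_arcs (with_proj G) ?v"
    then obtain u where u: "e = (?v, u)" "(?v, u) \<in> parcs G" by (cases e) auto
    then have "u \<in> set (vertex_list G)" using in_arcsD2 vl by auto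
    then obtain j where "j < ?n" "u = vertex_list G ! j" using vl by (metis in_set_conv_nth)
    then show "e \<in> (\<lambda>j. (?v, vertex_list G ! j)) ` {j. j < ?n \<and> adjacent G i j}"
      using u by (auto simp: adjacent_def)
  qed (auto simp: adjacent_def)
  moreover have "inj_on (\<lambda>j. (?v, vertex_list G ! j)) {j. j < ?n \<and> adjacent G i j}"
    using vl by (auto simp: inj_on_def nth_eq_iff_index_eq)
  ultimately have "out_degree (with_proj G) ?v = card {j. j < ?n \<and> adjacent G i j}"
    by (simp add: out_degree_def card_image)
  also have "{j. j < ?n \<and> adjacent G i j} = {..<?n} \<inter> {j. adjacent G i j}" by auto
  finally show ?thesis by (simp add: sum.If_cases)
qed

lemma laplacian_apply:
  assumes "pair_graph G" "i < card (pverts G)"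
  shows "(\<Sum>j<card (pverts G). laplacian G $$ (i, j) * x j)
    = (\<Sum>j<card (pverts G). if adjacent G i j then x i - x j else 0)"
proof -
  let ?n = "card (pverts G)" and ?d = "real (out_degree (with_proj G) (vertex_list G ! i))"
  have "laplacian G $$ (i, j) = (if i = j then ?d else 0) - (if adjacent G i j then 1 else 0)"
    if "j < ?n" for j
    using assms(2) that
    by (simp add: laplacian_def degree_matrix_def adjacency_matrix_def adjacent_def)
  then have "laplacian G $$ (i, j) * x j
      = (if i = j then ?d * x j else 0) - (if adjacent G i j then x j else 0)" if "j < ?n" for j
    using that by (auto simp: left_diff_distrib)
  then have "(\<Sum>j<?n. laplacian G $$ (i, j) * x j)
      = ?d * x i - (\<Sum>j<?n. if adjacent G i j then x j else 0)"
    using assms by (simp add: sum_subtractf)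
  also have "\<dots> = (\<Sum>j<?n. (if adjacent G i j then 1 else 0) * x i - (if adjacent G i j then x j else 0))"
    unfolding out_degree_vertex_list[OF assms] by (simp only: sum_subtractf sum_distrib_right)
  also have "\<dots> = (\<Sum>j<?n. if adjacent G i j then x i - x j else 0)"
    by (rule sum.cong) auto
  finally show ?thesis .
qed

lemma laplacian_eigenvector:
  assumes G: "pair_graph G" and n: "2 \<le> card (pverts G)"
  shows "\<exists>x. (\<forall>i<card (pverts G). (\<Sum>j<card (pverts G). if adjacent G i j then x i - x j else 0)
      = laplacian_eigenvalue 2 G * x i)
    \<and> (\<Sum>i<card (pverts G). x i) = 0 \<and> (\<exists>i<card (pverts G). x i \<noteq> 0)"
proof -
  interpret pair_graph G by fact
  let ?L = "laplacian G"
  obtain m where m: "card (pverts G) = Suc m" "0 < m" using n by (cases "card (pverts G)") auto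
  have adj_sym: "adjacent G i j \<longleftrightarrow> adjacent G j i" for i j
    using pair_sym_arcs by (auto simp: adjacent_def symmetric_def sym_def)
  have L: "?L \<in> carrier_mat (Suc m) (Suc m)"
    by (intro carrier_matI) (simp_all add: laplacian_def degree_matrix_def adjacency_matrix_def m)
  have sym: "?L $$ (i, j) = ?L $$ (j, i)" if "i < Suc m" "j < Suc m" for i j
    using that adj_sym[of i j]
    by (auto simp: laplacian_def degree_matrix_def adjacency_matrix_def adjacent_def m)
  have col: "(\<Sum>i<Suc m. ?L $$ (i, j)) = 0" if "j < Suc m" for j
  proof -
    \<comment> \<open>By symmetry the column sums are row sums, that is, the Laplacian applied to
      the constant 1.\<close>
    have "(\<Sum>i<Suc m. ?L $$ (i, j)) = (\<Sum>i<Suc m. ?L $$ (j, i) * 1)"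
      by (rule sum.cong) (use sym that in auto)
    also have "\<dots> = 0" using laplacian_apply[OF G, of j "\<lambda>_. 1"] that m by (simp cong: if_cong)
    finally show ?thesis .
  qed
  \<comment> \<open>Used twice: to see that all roots of the deflated polynomial are nonnegative,
    and for the root \<open>laplacian_eigenvalue 2 G\<close>.\<close>
  have ev: "\<exists>x. (\<forall>i<Suc m. (\<Sum>j<Suc m. if adjacent G i j then x i - x j else 0) = k * x i)
      \<and> (\<Sum>i<Suc m. x i) = 0 \<and> (\<exists>i<Suc m. x i \<noteq> 0)"
    if k: "poly (char_poly (deflate ?L)) k = 0" for k
  proof -
    have "(\<Sum>j<Suc m. ?L $$ (i, j) * x j) = (\<Sum>j<Suc m. if adjacent G i j then x i - x j else 0)"
      if "i < Suc m" for i x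
      using laplacian_apply[OF G, of i x] that by (simp only: m)
    with eigenvalue_deflate[OF L col k] show ?thesis by (simp del: sum.lessThan_Suc cong: conj_cong)
  qed
  have "0 \<le> k" if "poly (char_poly (deflate ?L)) k = 0" for k
  proof -
    from ev[OF that] obtain x i where
      x: "\<forall>i<Suc m. (\<Sum>j<Suc m. if adjacent G i j then x i - x j else 0) = k * x i"
      "i < Suc m" "x i \<noteq> 0" by blast
    show ?thesis
      by (rule difference_eigenvalue_nonneg[of "{..<Suc m}" "adjacent G" x k i])
        (use x in \<open>simp_all del: sum.lessThan_Suc\<close>)
  qed
  then have "poly (char_poly (deflate ?L)) (laplacian_eigenvalue 2 G) = 0"
    using second_root[OF L m(2) sym col]
    by (simp add: laplacian_eigenvalue_def laplacian_eigenvalues_def)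
  from ev[OF this] show ?thesis unfolding m .
qed

text \<open>\<open>vertex_list\<close> depends only on the vertex set, so a graph and its complement
  number their vertices alike.\<close>

lemma adjacent_complement:
  assumes "finite (pverts G)" "i < card (pverts G)" "j < card (pverts G)"
  shows "adjacent (complement G) i j \<longleftrightarrow> i \<noteq> j \<and> \<not> adjacent G i j"
proof -
  have "vertex_list (complement G) = vertex_list G"
    by (simp add: vertex_list_def complement_def)
  moreover have "vertex_list G ! i \<in> pverts G" "vertex_list G ! j \<in> pverts G"
    using assms vertex_list[of G] nth_mem by metis+
  moreover have "vertex_list G ! i = vertex_list G ! j \<longleftrightarrow> i = j"
    using assms vertex_list[of G] by (simp add: nth_eq_iff_index_eq)
  ultimately show ?thesis by (auto simp: adjacent_def complement_def)
qed

theorem theorem2: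
  fixes G :: "'a pair_pre_digraph"
  assumes "pair_graph G"
    and "card (pverts G) \<ge> 2"
  shows "max (laplacian_eigenvalue 2 G) (laplacian_eigenvalue 2 (complement G)) \<ge> 2 / 5"
proof (rule ccontr)
  interpret pair_graph G by fact
  let ?n = "card (pverts G)" and ?R = "adjacent G" and ?R' = "\<lambda>i j. i \<noteq> j \<and> \<not> adjacent G i j"
  let ?l = "laplacian_eigenvalue 2 G" and ?m = "laplacian_eigenvalue 2 (complement G)"
  assume "\<not> ?thesis"
  then have small: "?l < 2 / 5" "?m < 2 / 5" by auto
  have sym: "?R j i" if "?R i j" for i j
    using pair_sym_arcs that by (auto simp: adjacent_def symmetric_def sym_def)
  have irrefl: "\<not> ?R i i" for i
    using pair_no_loops by (fastforce simp: adjacent_def)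
  have n: "card (pverts (complement G)) = ?n" by (simp add: complement_def)
  obtain x where x: "\<forall>i<?n. (\<Sum>j<?n. if ?R i j then x i - x j else 0) = ?l * x i"
    "(\<Sum>i<?n. x i) = 0" "\<exists>i<?n. x i \<noteq> 0"
    using laplacian_eigenvector[OF assms] by blast
  have "\<exists>y a b. fiedler {..<?n} ?R y ?l a b"
    by (rule fiedler_exists[of _ _ x]) (use x sym irrefl small in auto)
  then obtain x' a b where G: "fiedler {..<?n} ?R x' ?l a b" by blast
  obtain y where
    y: "\<forall>i<?n. (\<Sum>j<?n. if adjacent (complement G) i j then y i - y j else 0) = ?m * y i"
    "(\<Sum>i<?n. y i) = 0" "\<exists>i<?n. y i \<noteq> 0"
    using laplacian_eigenvector[OF pair_graph_complement[OF assms(1)]] assms(2) unfolding n by blast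
  \<comment> \<open>\<open>?R'\<close> is the form of the complement that
    \<open>no_fiedler_pair\<close> expects; it is compared with adjacency in
    \<open>complement G\<close> at indices below \<open>?n\<close>.\<close>
  have "(\<Sum>j<?n. if ?R' i j then y i - y j else 0) = ?m * y i" if "i < ?n" for i
    unfolding y(1)[rule_format, OF that, symmetric]
    by (rule sum.cong) (use adjacent_complement[OF pair_finite_verts] that in auto)
  then have "\<exists>y a b. fiedler {..<?n} ?R' y ?m a b"
    by (intro fiedler_exists[of _ _ y]) (use y sym small in auto)
  then obtain y' c d where "fiedler {..<?n} ?R' y' ?m c d" by blast
  with G show False by (rule no_fiedler_pair)
qed

end
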